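(* The discrete Maxwell's equations are variational, in the following sense. Let $K$ be a finite oriented $4$-dimensional discrete spacetime mesh with dual mesh $*K$, let $\mathcal{J}$ be a given dual discrete $3$-form (source), and for each primal discrete $1$-form $A$ on $K$ define the discrete Lagrangian $4$-form and the discrete action $$\mathcal{L}_d=-\tfrac12\,\mathrm{d}A\wedge *\mathrm{d}A+A\wedge\mathcal{J},\qquad S_d[A]=\langle \mathcal{L}_d,K\rangle .$$ Then $A$ satisfies the discrete stationary-action principle, i.e. $\frac{\mathrm{d}}{\mathrm{d}\epsilon}\big|_{\epsilon=0}S_d[A+\epsilon\alpha]=0$ for every primal discrete $1$-form $\alpha$ vanishing on all edges contained in $\partial K$, if and only if $A$ satisfies the discrete Euler--Lagrange equations $$\mathrm{d}{*\mathrm{d}A}=\mathcal{J}$$ (evaluated on the dual $3$-cells $*e$ of the edges $e$ of $K$ not contained in $\partial K$). Consequently, for such $A$, the discrete $2$-forms $F=\mathrm{d}A$ (primal) and $G=*F$ (dual) satisfy the discrete Maxwell's equations $$\mathrm{d}F=0,\qquad \mathrm{d}G=\mathcal{J}.$$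
   Context: Discrete exterior calculus (DEC) conventions, spacetime dimension $n=4$. Mesh: $K$ is a finite, oriented, manifold cell complex of dimension $4$ (for instance a simplicial complex, a rectangular grid, or a prismal mesh) in Lorentzian spacetime $\mathbb{R}^{3,1}$. Each primal $k$-cell $\sigma$ has a dual $(4-k)$-cell $*\sigma$ in the dual mesh $*K$ (by default the circumcentric dual, restricted to $K$). The volumes $|\sigma|$ and $|*\sigma|$ of primal $2$-cells and their duals are assumed nonzero. The causality sign $\kappa(\sigma)$ is $+1$ if $\sigma$ is spacelike and $-1$ otherwise. Discrete forms: a primal discrete $k$-form $\alpha$ assigns a real number $\langle\alpha,\sigma\rangle$ to each oriented primal $k$-cell $\sigma$, extended linearly to chains (reversing orientation changes the sign). A dual discrete $k$-form does the same on dual $k$-cells. "$\alpha$ vanishes on $\partial K$" means $\langle\alpha,\sigma\rangle=0$ for all cells $\sigma\subset\partial K$. Exterior derivative: $\langle\mathrm{d}\alpha,\sigma\rangle=\langle\alpha,\partial\sigma\rangle$ for every $(k+1)$-chain $\sigma$, on both primal and dual meshes (so $\mathrm{d}^2=0$). Explicitly, for a dual $2$-form $\eta$ and an edge $e$ not contained in $\partial K$, with the orientation convention matching the smooth Leibniz rule, $\langle\mathrm{d}\eta,*e\rangle=\sum_{\sigma^2\supset e}[\sigma^2:e]\,\langle\eta,*\sigma^2\rangle$, where $[\sigma^2:e]\in\{\pm1\}$ is the incidence number (the coefficient of $e$ in $\partial\sigma^2$). Diagonal Hodge star (primal $k$-forms to dual $(4-k)$-forms): $\frac{1}{|*\sigma|}\langle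 *\alpha,*\sigma\rangle=\kappa(\sigma)\frac{1}{|\sigma|}\langle\alpha,\sigma\rangle$. Only the Hodge star on $2$-forms is used. Primal-dual wedge pairing: for a primal $k$-form $\alpha$ and a dual $(4-k)$-form $\eta$, $\langle\alpha\wedge\eta,K\rangle=\sum_{\sigma^k}\langle\alpha,\sigma^k\rangle\langle\eta,*\sigma^k\rangle$, the sum being over all $k$-cells of $K$; thus $\langle\alpha\wedge*\beta,K\rangle=(\alpha,\beta)=\sum_{\sigma^k}\kappa(\sigma^k)\frac{|*\sigma^k|}{|\sigma^k|}\langle\alpha,\sigma^k\rangle\langle\beta,\sigma^k\rangle$. *)

theory Defs
  imports "HOL-Analysis.Analysis"
begin

section \<open>Lorentzian spacetime\<close>

text \<open>Coordinates 1, 2, 3 are spatial and coordinate 4 is time; the signature is \<open>(+,+,+,-)\<close>.\<close>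

type_synonym point = "real^4"
type_synonym cell = "point set"

definition mink :: "point \<Rightarrow> point \<Rightarrow> real" where
  "mink u v = u$1 * v$1 + u$2 * v$2 + u$3 * v$3 - u$4 * v$4"

text \<open>The 2-dimensional Lorentzian area of the parallelogram spanned by two vectors.\<close>

definition parallelogram_area :: "point \<Rightarrow> point \<Rightarrow> real" where
  "parallelogram_area u v = sqrt \<bar>mink u u * mink v v - (mink u v)\<^sup>2\<bar>"

definition plane_frame :: "cell \<Rightarrow> point \<Rightarrow> point \<Rightarrow> point \<Rightarrow> bool" where
  "plane_frame \<sigma> p u v \<longleftrightarrow> u \<noteq> v \<and> independent {u, v} \<and>
     affine hull \<sigma> = {p + s *\<^sub>R u + t *\<^sub>R v | s t. True}"

text \<open>Area \<open>|\<sigma>|\<close> of a flat 2-cell: the Lebesgue measure of the cell in affine coordinates of its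
  plane, times the Lorentzian area of the coordinate parallelogram.  The value does not depend
  on the chosen coordinates.\<close>

definition area :: "cell \<Rightarrow> real" where
  "area \<sigma> = (SOME a. \<exists>p u v. plane_frame \<sigma> p u v \<and>
     a = measure lborel {(s::real, t::real). p + s *\<^sub>R u + t *\<^sub>R v \<in> \<sigma>} * parallelogram_area u v)"

definition triangle_area :: "point \<Rightarrow> point \<Rightarrow> point \<Rightarrow> real" where
  "triangle_area x y z = parallelogram_area (y - x) (z - x) / 2"

definition spacelike :: "cell \<Rightarrow> bool" where
  "spacelike \<sigma> \<longleftrightarrow>
     (\<forall>x\<in>affine hull \<sigma>. \<forall>y\<in>affine hull \<sigma>. x \<noteq> y \<longrightarrow> mink (x - y) (x - y) > 0)"

definition causality_sign :: "cell \<Rightarrow> real" where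
  "causality_sign \<sigma> = (if spacelike \<sigma> then 1 else -1)"


section \<open>Meshes\<close>

text \<open>\<open>cells K k\<close> are the closed \<open>k\<close>-cells and \<open>inc K \<sigma> \<tau>\<close> is the incidence number \<open>[\<sigma>:\<tau>]\<close>, the
  coefficient of \<open>\<tau>\<close> in \<open>\<partial>\<sigma>\<close>; these numbers carry the orientations of the cells.

  The last two fields determine the dual mesh.  The dual of a \<open>k\<close>-cell \<open>\<sigma>\<close> is made up of the
  elementary simplices with vertices \<open>center \<sigma>\<^sub>k, \<dots>, center \<sigma>\<^sub>4\<close>, one for each flag
  \<open>\<sigma> = \<sigma>\<^sub>k \<subset> \<dots> \<subset> \<sigma>\<^sub>4\<close> of cells of the mesh (so it is restricted to the mesh).  The circumcentric
  dual takes the Lorentzian circumcenters as centers; the barycentric dual is another instance.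
  Only the volumes of duals of 2-cells are needed, hence \<open>dual_sign\<close> gives the sign with which a
  flag of a 2-, a 3- and a 4-cell contributes to the volume; it is constantly 1 if volumes are
  unsigned, and may be negative in the usual signed convention for cells that do not contain
  their circumcenter.\<close>

record mesh =
  cells :: "nat \<Rightarrow> cell set"
  inc :: "cell \<Rightarrow> cell \<Rightarrow> int"
  center :: "cell \<Rightarrow> point"
  dual_sign :: "cell \<Rightarrow> cell \<Rightarrow> cell \<Rightarrow> real"

definition all_cells :: "mesh \<Rightarrow> cell set" where
  "all_cells K = (\<Union>k\<le>4. cells K k)"

definition mesh_space :: "mesh \<Rightarrow> point set" where
  "mesh_space K = \<Union>(all_cells K)"

text \<open>The underlying set of \<open>\<partial>K\<close>: the union of the 3-cells that are faces of exactly one 4-cell.\<close>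

definition mesh_boundary :: "mesh \<Rightarrow> point set" where
  "mesh_boundary K = \<Union>{\<tau> \<in> cells K 3. card {\<rho> \<in> cells K 4. \<tau> \<subseteq> \<rho>} = 1}"

text \<open>A finite regular cell complex, pure of dimension 4, with flat cells.  A flat cell that is a
  topological ball has its relative frontier as bounding sphere.\<close>

definition cell_complex4 :: "mesh \<Rightarrow> bool" where
  "cell_complex4 K \<longleftrightarrow>
     (\<forall>k. finite (cells K k)) \<and> (\<forall>k>4. cells K k = {}) \<and> cells K 4 \<noteq> {} \<and>
     (\<forall>k. \<forall>\<sigma>\<in>cells K k. aff_dim \<sigma> = int k \<and>
        (\<exists>B::point set. convex B \<and> compact B \<and> aff_dim B = int k \<and> \<sigma> homeomorphic B)) \<and>
     (\<forall>k. \<forall>\<sigma>\<in>cells K (Suc k). rel_frontier \<sigma> = \<Union>{\<tau> \<in> cells K k. \<tau> \<subseteq> \<sigma>}) \<and>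
     (\<forall>\<sigma>\<in>all_cells K. \<forall>\<tau>\<in>all_cells K. \<sigma> \<noteq> \<tau> \<longrightarrow> rel_interior \<sigma> \<inter> rel_interior \<tau> = {}) \<and>
     (\<forall>\<sigma>\<in>all_cells K. \<exists>\<rho>\<in>cells K 4. \<sigma> \<subseteq> \<rho>)"

text \<open>A topological 4-manifold with boundary.\<close>

definition manifold4 :: "point set \<Rightarrow> bool" where
  "manifold4 M \<longleftrightarrow> (\<forall>x\<in>M. \<exists>U V. openin (top_of_set M) U \<and> x \<in> U \<and>
     openin (top_of_set {y::point. 0 \<le> y$1}) V \<and> U homeomorphic V)"

text \<open>An incidence function of a regular cell complex, i.e. a choice of orientation of every cell
  (vertices being positively oriented), such that the orientations of the 4-cells are coherent:
  the 3-cells inside \<open>K\<close> cancel in the boundary of the chain of all 4-cells.\<close>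

definition oriented_mesh :: "mesh \<Rightarrow> bool" where
  "oriented_mesh K \<longleftrightarrow>
     (\<forall>k. \<forall>\<sigma>\<in>cells K (Suc k). \<forall>\<tau>\<in>cells K k.
        inc K \<sigma> \<tau> \<in> (if \<tau> \<subseteq> \<sigma> then {1, -1} else {0})) \<and>
     (\<forall>e\<in>cells K 1. (\<Sum>v\<in>cells K 0. inc K e v) = 0) \<and>
     (\<forall>k. \<forall>\<sigma>\<in>cells K (k + 2). \<forall>\<rho>\<in>cells K k.
        (\<Sum>\<tau>\<in>cells K (k + 1). inc K \<sigma> \<tau> * inc K \<tau> \<rho>) = 0) \<and>
     (\<forall>\<tau>\<in>cells K 3. \<not> \<tau> \<subseteq> mesh_boundary K \<longrightarrow> (\<Sum>\<rho>\<in>cells K 4. inc K \<rho> \<tau>) = 0)"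

definition dual_area :: "mesh \<Rightarrow> cell \<Rightarrow> real" where
  "dual_area K \<sigma> = (\<Sum>\<tau>\<in>{\<tau> \<in> cells K 3. \<sigma> \<subseteq> \<tau>}. \<Sum>\<rho>\<in>{\<rho> \<in> cells K 4. \<tau> \<subseteq> \<rho>}.
     dual_sign K \<sigma> \<tau> \<rho> * triangle_area (center K \<sigma>) (center K \<tau>) (center K \<rho>))"

definition dual_mesh_data :: "mesh \<Rightarrow> bool" where
  "dual_mesh_data K \<longleftrightarrow>
     (\<forall>\<sigma>\<in>all_cells K. center K \<sigma> \<in> affine hull \<sigma>) \<and>
     (\<forall>\<sigma>\<in>cells K 2. \<forall>\<tau>\<in>cells K 3. \<forall>\<rho>\<in>cells K 4. \<sigma> \<subseteq> \<tau> \<longrightarrow> \<tau> \<subseteq> \<rho> \<longrightarrow>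
        dual_sign K \<sigma> \<tau> \<rho> \<in> {1, -1})"

definition spacetime_mesh :: "mesh \<Rightarrow> bool" where
  "spacetime_mesh K \<longleftrightarrow>
     cell_complex4 K \<and> manifold4 (mesh_space K) \<and> oriented_mesh K \<and> dual_mesh_data K \<and>
     (\<forall>\<sigma>\<in>cells K 2. area \<sigma> \<noteq> 0 \<and> dual_area K \<sigma> \<noteq> 0)"


section \<open>Discrete forms\<close>

text \<open>\<open>Star \<sigma>\<close> names the dual cell \<open>*\<sigma>\<close>.  A label is used because distinct dual cells could have the
  same carrier in degenerate positions.  Forms are given by their values on the chosen
  orientations of the cells and extend linearly to chains; values of a primal \<open>k\<close>-form outside
  \<open>cells K k\<close> (and of a dual \<open>k\<close>-form outside the duals of \<open>cells K (4 - k)\<close>) are irrelevant.\<close>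

datatype dual_cell = Star (primal: cell)

type_synonym primal_form = "cell \<Rightarrow> real"
type_synonym dual_form = "dual_cell \<Rightarrow> real"

text \<open>The exterior derivative of a primal \<open>k\<close>-form, evaluated on \<open>(k+1)\<close>-cells.\<close>

definition ext_d :: "mesh \<Rightarrow> nat \<Rightarrow> primal_form \<Rightarrow> primal_form" where
  "ext_d K k \<alpha> \<sigma> = (\<Sum>\<tau>\<in>{\<tau> \<in> cells K k. \<tau> \<subseteq> \<sigma>}. of_int (inc K \<sigma> \<tau>) * \<alpha> \<tau>)"

text \<open>The exterior derivative of a dual \<open>p\<close>-form on the dual of a \<open>(3-p)\<close>-cell not contained in
  \<open>\<partial>K\<close> (duals of cells in \<open>\<partial>K\<close> have further boundary parts that are not duals of cells).  The sign
  is the one of the Leibniz rule \<open>d(\<alpha> \<and> \<eta>) = d\<alpha> \<and> \<eta> + (-1)\<^sup>k \<alpha> \<and> d\<eta>\<close> with \<open>k = 3 - p\<close>; it is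
  \<open>+1\<close> for dual 2-forms.\<close>

definition dual_ext_d :: "mesh \<Rightarrow> nat \<Rightarrow> dual_form \<Rightarrow> dual_form" where
  "dual_ext_d K p \<eta> c = (-1) ^ p *
     (\<Sum>\<sigma>\<in>{\<sigma> \<in> cells K (4 - p). primal c \<subseteq> \<sigma>}. of_int (inc K \<sigma> (primal c)) * \<eta> (Star \<sigma>))"

text \<open>The diagonal Hodge star on primal 2-forms:
  \<open>\<langle>*\<alpha>,*\<sigma>\<rangle> / |*\<sigma>| = \<kappa>(\<sigma>) \<langle>\<alpha>,\<sigma>\<rangle> / |\<sigma>|\<close>.\<close>

definition hodge2 :: "mesh \<Rightarrow> primal_form \<Rightarrow> dual_form" where
  "hodge2 K \<alpha> c = causality_sign (primal c) * (dual_area K (primal c) / area (primal c)) * \<alpha> (primal c)"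

text \<open>A primal-dual wedge product is a 4-form assigning a value to the support volume spanned by a
  cell and its dual.  Such a 4-form is represented as a function on cells, \<open>\<sigma>\<close> standing for the
  support volume of \<open>\<sigma>\<close> and \<open>*\<sigma>\<close>, so that 4-forms from wedges of different degrees can be added.\<close>

type_synonym volume_form = "cell \<Rightarrow> real"

definition wedge :: "mesh \<Rightarrow> nat \<Rightarrow> primal_form \<Rightarrow> dual_form \<Rightarrow> volume_form" where
  "wedge K k \<alpha> \<eta> \<sigma> = (if \<sigma> \<in> cells K k then \<alpha> \<sigma> * \<eta> (Star \<sigma>) else 0)"

definition integrate :: "mesh \<Rightarrow> volume_form \<Rightarrow> real" where
  "integrate K \<omega> = (\<Sum>\<sigma>\<in>all_cells K. \<omega> \<sigma>)"

definition lagrangian :: "mesh \<Rightarrow> dual_form \<Rightarrow> primal_form \<Rightarrow> volume_form" where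
  "lagrangian K J A \<sigma> =
     - (1/2) * wedge K 2 (ext_d K 1 A) (hodge2 K (ext_d K 1 A)) \<sigma> + wedge K 1 A J \<sigma>"

definition action :: "mesh \<Rightarrow> dual_form \<Rightarrow> primal_form \<Rightarrow> real" where
  "action K J A = integrate K (lagrangian K J A)"

definition vanishes_on_boundary :: "mesh \<Rightarrow> nat \<Rightarrow> primal_form \<Rightarrow> bool" where
  "vanishes_on_boundary K k \<alpha> \<longleftrightarrow> (\<forall>\<sigma>\<in>cells K k. \<sigma> \<subseteq> mesh_boundary K \<longrightarrow> \<alpha> \<sigma> = 0)"

definition stationary_action :: "mesh \<Rightarrow> dual_form \<Rightarrow> primal_form \<Rightarrow> bool" where
  "stationary_action K J A \<longleftrightarrow> (\<forall>\<alpha>. vanishes_on_boundary K 1 \<alpha> \<longrightarrow>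
     ((\<lambda>\<epsilon>. action K J (\<lambda>e. A e + \<epsilon> * \<alpha> e)) has_real_derivative 0) (at 0))"

definition interior_edges :: "mesh \<Rightarrow> cell set" where
  "interior_edges K = {e \<in> cells K 1. \<not> e \<subseteq> mesh_boundary K}"

end

theory Submission
  imports Defs
begin

text \<open>
  The action is a quadratic polynomial in the potential, because \<open>d\<close> and the diagonal Hodge star are
  linear and the Hodge pairing \<open>(\<alpha>, \<beta>) = \<langle>\<alpha> \<and> *\<beta>, K\<rangle>\<close> is symmetric.  Hence
  \<open>S[A + \<epsilon> \<alpha>] = S[A] + \<epsilon> (\<langle>\<alpha> \<and> J, K\<rangle> - \<langle>d\<alpha> \<and> *dA, K\<rangle>) - \<epsilon>\<^sup>2/2 (d\<alpha>, d\<alpha>)\<close> exactly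
  (\<open>action_perturbation\<close>), and the first variation is the coefficient of \<open>\<epsilon>\<close>.

  The dual exterior derivative is the transpose of the primal one with respect to the primal-dual
  pairing: both are given by the same incidence numbers, summed over cofaces instead of faces.  So
  \<open>\<langle>d\<alpha> \<and> *dA, K\<rangle> = \<langle>\<alpha> \<and> d*dA, K\<rangle>\<close> (\<open>summation_by_parts\<close>).  For a general \<open>\<alpha>\<close> the right side contains
  terms at edges in \<open>\<partial>K\<close>, where the formula for \<open>d\<close> on dual forms omits the part of the boundary of
  \<open>*e\<close> lying in \<open>\<partial>K\<close>; these terms disappear when \<open>\<alpha>\<close> vanishes on \<open>\<partial>K\<close>.  What remains is
  \<open>\<Sum>\<alpha>(e) (J - d*dA)(*e)\<close> over the interior edges.  The values \<open>\<alpha>(e)\<close> there are arbitrary, so this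
  vanishes for every admissible \<open>\<alpha>\<close> if and only if \<open>d*dA = J\<close> on the dual of every interior edge
  (\<open>fundamental_lemma\<close>).

  Of the two Maxwell equations, \<open>dG = J\<close> is the Euler-Lagrange equation itself, and \<open>dF = 0\<close> is the
  identity \<open>d\<^sup>2 = 0\<close>, which is dual to the vanishing of the boundary of a boundary.
\<close>

lemma finite_cells: "spacetime_mesh K \<Longrightarrow> finite (cells K k)"
  unfolding spacetime_mesh_def cell_complex4_def by (elim conjE) (erule spec)

lemma finite_all_cells: "spacetime_mesh K \<Longrightarrow> finite (all_cells K)"
  unfolding all_cells_def by (simp add: finite_cells)

lemma integrate_wedge:
  assumes "spacetime_mesh K" "k \<le> 4"
  shows "integrate K (wedge K k \<alpha> \<eta>) = (\<Sum>\<sigma>\<in>cells K k. \<alpha> \<sigma> * \<eta> (Star \<sigma>))"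
proof -
  have "cells K k \<subseteq> all_cells K"
    using \<open>k \<le> 4\<close> by (auto simp: all_cells_def)
  then show ?thesis
    unfolding integrate_def
    by (intro sum.mono_neutral_cong_right finite_all_cells[OF assms(1)]) (auto simp: wedge_def)
qed

text \<open>Both sides are the double sum of \<open>[\<sigma>:\<tau>] \<alpha>(\<tau>) \<eta>(*\<sigma>)\<close> over the pairs \<open>\<tau> \<subseteq> \<sigma>\<close>, summed in the
  two possible orders.  The sign undoes the Leibniz sign in the definition of \<open>d\<close> on dual forms.\<close>

lemma summation_by_parts:
  assumes K: "spacetime_mesh K" and k: "k \<le> 3"
  shows "integrate K (wedge K (Suc k) (ext_d K k \<alpha>) \<eta>)
       = (-1) ^ (3 - k) * integrate K (wedge K k \<alpha> (dual_ext_d K (3 - k) \<eta>))"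
proof -
  have deg: "4 - (3 - k) = Suc k" and le: "Suc k \<le> 4" "k \<le> 4"
    using k by auto
  have "(\<Sum>\<sigma>\<in>cells K (Suc k). ext_d K k \<alpha> \<sigma> * \<eta> (Star \<sigma>))
      = (\<Sum>\<sigma>\<in>cells K (Suc k). \<Sum>\<tau>\<in>{\<tau> \<in> cells K k. \<tau> \<subseteq> \<sigma>}. inc K \<sigma> \<tau> * \<alpha> \<tau> * \<eta> (Star \<sigma>))"
    by (simp add: ext_d_def sum_distrib_right)
  also have "\<dots> = (\<Sum>\<tau>\<in>cells K k. \<Sum>\<sigma>\<in>{\<sigma> \<in> cells K (Suc k). \<tau> \<subseteq> \<sigma>}. inc K \<sigma> \<tau> * \<alpha> \<tau> * \<eta> (Star \<sigma>))"
    by (rule sum.swap_restrict) (simp_all add: finite_cells[OF K])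
  also have "\<dots> = (\<Sum>\<tau>\<in>cells K k. (-1) ^ (3 - k) * (\<alpha> \<tau> * dual_ext_d K (3 - k) \<eta> (Star \<tau>)))"
  proof (rule sum.cong[OF refl])
    fix \<tau>
    let ?s = "\<Sum>\<sigma>\<in>{\<sigma> \<in> cells K (Suc k). \<tau> \<subseteq> \<sigma>}. inc K \<sigma> \<tau> * \<eta> (Star \<sigma>)"
    have "(\<Sum>\<sigma>\<in>{\<sigma> \<in> cells K (Suc k). \<tau> \<subseteq> \<sigma>}. inc K \<sigma> \<tau> * \<alpha> \<tau> * \<eta> (Star \<sigma>)) = \<alpha> \<tau> * ?s"
      unfolding sum_distrib_left by (rule sum.cong[OF refl]) (simp only: mult_ac)
    moreover have "?s = (-1) ^ (3 - k) * dual_ext_d K (3 - k) \<eta> (Star \<tau>)"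
      unfolding dual_ext_d_def deg dual_cell.sel by (simp only: left_minus_one_mult_self)
    ultimately show "(\<Sum>\<sigma>\<in>{\<sigma> \<in> cells K (Suc k). \<tau> \<subseteq> \<sigma>}. inc K \<sigma> \<tau> * \<alpha> \<tau> * \<eta> (Star \<sigma>))
        = (-1) ^ (3 - k) * (\<alpha> \<tau> * dual_ext_d K (3 - k) \<eta> (Star \<tau>))"
      by (simp only: mult.left_commute)
  qed
  also have "\<dots> = (-1) ^ (3 - k) * (\<Sum>\<tau>\<in>cells K k. \<alpha> \<tau> * dual_ext_d K (3 - k) \<eta> (Star \<tau>))"
    by (rule sum_distrib_left[symmetric])
  finally show ?thesis
    by (simp only: integrate_wedge[OF K le(1)] integrate_wedge[OF K le(2)])
qed

text \<open>The coefficient of \<open>\<alpha>(\<rho>)\<close> in \<open>\<langle>dd\<alpha>, \<sigma>\<rangle>\<close> is \<open>\<Sum>[\<sigma>:\<tau>][\<tau>:\<rho>]\<close>, the coefficient of \<open>\<rho>\<close> in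
  \<open>\<partial>\<partial>\<sigma>\<close>.\<close>

lemma ext_d_ext_d:
  assumes K: "spacetime_mesh K" and \<sigma>: "\<sigma> \<in> cells K (k + 2)"
  shows "ext_d K (k + 1) (ext_d K k \<alpha>) \<sigma> = 0"
proof -
  have incidence: "\<forall>k. \<forall>\<sigma>\<in>cells K (Suc k). \<forall>\<tau>\<in>cells K k.
      inc K \<sigma> \<tau> \<in> (if \<tau> \<subseteq> \<sigma> then {1, -1} else {0})"
    and boundary_boundary: "\<forall>k. \<forall>\<sigma>\<in>cells K (k + 2). \<forall>\<rho>\<in>cells K k.
      (\<Sum>\<tau>\<in>cells K (k + 1). inc K \<sigma> \<tau> * inc K \<tau> \<rho>) = 0"
    using K unfolding spacetime_mesh_def oriented_mesh_def by argo+
  \<comment> \<open>Incidence numbers vanish off the faces, so the sums may run over all cells of the dimension.\<close>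
  have all_faces: "ext_d K j \<beta> \<upsilon> = (\<Sum>\<tau>\<in>cells K j. inc K \<upsilon> \<tau> * \<beta> \<tau>)"
    if "\<upsilon> \<in> cells K (Suc j)" for j \<upsilon> and \<beta> :: primal_form
    unfolding ext_d_def
  proof (rule sum.mono_neutral_left)
    show "\<forall>\<tau>\<in>cells K j - {\<tau> \<in> cells K j. \<tau> \<subseteq> \<upsilon>}. inc K \<upsilon> \<tau> * \<beta> \<tau> = 0"
    proof
      fix \<tau> assume "\<tau> \<in> cells K j - {\<tau> \<in> cells K j. \<tau> \<subseteq> \<upsilon>}"
      then have "inc K \<upsilon> \<tau> = 0"
        using incidence[rule_format, OF that, of \<tau>] by simp
      then show "inc K \<upsilon> \<tau> * \<beta> \<tau> = 0"
        by simp
    qed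
  qed (auto simp: finite_cells[OF K])
  have "ext_d K (k + 1) (ext_d K k \<alpha>) \<sigma>
      = (\<Sum>\<tau>\<in>cells K (k + 1). inc K \<sigma> \<tau> * (\<Sum>\<rho>\<in>cells K k. inc K \<tau> \<rho> * \<alpha> \<rho>))"
    using \<sigma> by (simp add: all_faces)
  also have "\<dots> = (\<Sum>\<rho>\<in>cells K k. (\<Sum>\<tau>\<in>cells K (k + 1). real_of_int (inc K \<sigma> \<tau>) * inc K \<tau> \<rho>) * \<alpha> \<rho>)"
    unfolding sum_distrib_left sum_distrib_right mult.assoc by (rule sum.swap)
  also have "\<dots> = (\<Sum>\<rho>\<in>cells K k. of_int (\<Sum>\<tau>\<in>cells K (k + 1). inc K \<sigma> \<tau> * inc K \<tau> \<rho>) * \<alpha> \<rho>)"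
    by simp
  also have "\<dots> = 0"
  proof (rule sum.neutral, rule ballI)
    fix \<rho> assume "\<rho> \<in> cells K k"
    then have "(\<Sum>\<tau>\<in>cells K (k + 1). inc K \<sigma> \<tau> * inc K \<tau> \<rho>) = 0"
      using boundary_boundary \<sigma> by blast
    then show "of_int (\<Sum>\<tau>\<in>cells K (k + 1). inc K \<sigma> \<tau> * inc K \<tau> \<rho>) * \<alpha> \<rho> = 0"
      by (simp only: of_int_0 mult_zero_left)
  qed
  finally show ?thesis .
qed

lemma ext_d_linear: "ext_d K k (\<lambda>\<tau>. \<alpha> \<tau> + c * \<beta> \<tau>) = (\<lambda>\<sigma>. ext_d K k \<alpha> \<sigma> + c * ext_d K k \<beta> \<sigma>)"
  unfolding ext_d_def by (simp add: fun_eq_iff algebra_simps sum.distrib sum_distrib_left)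

lemma action_eq:
  "action K J A = - (1/2) * integrate K (wedge K 2 (ext_d K 1 A) (hodge2 K (ext_d K 1 A)))
     + integrate K (wedge K 1 A J)"
  unfolding action_def lagrangian_def integrate_def
  by (simp only: sum.distrib sum_distrib_left)

text \<open>The two mixed terms of the quadratic part are equal because the Hodge star is diagonal; this
  cancels the factor \<open>1/2\<close> in the Lagrangian.\<close>

lemma action_perturbation:
  assumes K: "spacetime_mesh K"
  shows "action K J (\<lambda>e. A e + \<epsilon> * \<alpha> e) = action K J A
     + \<epsilon> * (integrate K (wedge K 1 \<alpha> J)
            - integrate K (wedge K 2 (ext_d K 1 \<alpha>) (hodge2 K (ext_d K 1 A))))
     - \<epsilon>\<^sup>2 / 2 * integrate K (wedge K 2 (ext_d K 1 \<alpha>) (hodge2 K (ext_d K 1 \<alpha>)))"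
proof -
  let ?dA = "ext_d K 1 A" and ?d\<alpha> = "ext_d K 1 \<alpha>"
  let ?Q = "\<lambda>\<beta> \<gamma>. integrate K (wedge K 2 \<beta> (hodge2 K \<gamma>))"
  have "?Q (\<lambda>\<sigma>. ?dA \<sigma> + \<epsilon> * ?d\<alpha> \<sigma>) (\<lambda>\<sigma>. ?dA \<sigma> + \<epsilon> * ?d\<alpha> \<sigma>)
      = (\<Sum>\<sigma>\<in>cells K 2. ?dA \<sigma> * hodge2 K ?dA (Star \<sigma>)
          + 2 * \<epsilon> * (?d\<alpha> \<sigma> * hodge2 K ?dA (Star \<sigma>))
          + \<epsilon>\<^sup>2 * (?d\<alpha> \<sigma> * hodge2 K ?d\<alpha> (Star \<sigma>)))"
    unfolding integrate_wedge[OF K, of 2, simplified]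
    by (intro sum.cong refl, unfold hodge2_def dual_cell.sel) algebra
  also have "\<dots> = ?Q ?dA ?dA + 2 * \<epsilon> * ?Q ?d\<alpha> ?dA + \<epsilon>\<^sup>2 * ?Q ?d\<alpha> ?d\<alpha>"
    by (simp add: integrate_wedge[OF K] sum.distrib sum_distrib_left)
  finally have quadratic: "?Q (\<lambda>\<sigma>. ?dA \<sigma> + \<epsilon> * ?d\<alpha> \<sigma>) (\<lambda>\<sigma>. ?dA \<sigma> + \<epsilon> * ?d\<alpha> \<sigma>)
      = ?Q ?dA ?dA + 2 * \<epsilon> * ?Q ?d\<alpha> ?dA + \<epsilon>\<^sup>2 * ?Q ?d\<alpha> ?d\<alpha>" .
  have source: "integrate K (wedge K 1 (\<lambda>e. A e + \<epsilon> * \<alpha> e) J)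
      = integrate K (wedge K 1 A J) + \<epsilon> * integrate K (wedge K 1 \<alpha> J)"
    by (simp add: integrate_wedge[OF K] sum.distrib sum_distrib_left distrib_right mult.assoc)
  show ?thesis
    unfolding action_eq ext_d_linear quadratic source by (simp add: field_simps)
qed

lemma action_derivative:
  assumes K: "spacetime_mesh K"
  shows "((\<lambda>\<epsilon>. action K J (\<lambda>e. A e + \<epsilon> * \<alpha> e)) has_real_derivative
     (\<Sum>e\<in>cells K 1. \<alpha> e * (J (Star e) - dual_ext_d K 2 (hodge2 K (ext_d K 1 A)) (Star e)))) (at 0)"
proof -
  let ?V = "integrate K (wedge K 1 \<alpha> J)
    - integrate K (wedge K 2 (ext_d K 1 \<alpha>) (hodge2 K (ext_d K 1 A)))"
  have "((\<lambda>\<epsilon>. action K J (\<lambda>e. A e + \<epsilon> * \<alpha> e)) has_real_derivative ?V) (at 0)"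
    unfolding action_perturbation[OF K] by (auto intro!: derivative_eq_intros)
  moreover have "?V = (\<Sum>e\<in>cells K 1.
      \<alpha> e * (J (Star e) - dual_ext_d K 2 (hodge2 K (ext_d K 1 A)) (Star e)))"
    using summation_by_parts[OF K, of 1 \<alpha>]
    by (simp add: numeral_2_eq_2 integrate_wedge[OF K] right_diff_distrib sum_subtractf)
  ultimately show ?thesis
    by simp
qed

text \<open>Discrete counterpart of the fundamental lemma of the calculus of variations: the indicator of a
  single interior edge is an admissible variation.\<close>

lemma fundamental_lemma:
  assumes K: "spacetime_mesh K"
  shows "(\<forall>\<alpha>. vanishes_on_boundary K 1 \<alpha> \<longrightarrow> (\<Sum>e\<in>cells K 1. \<alpha> e * g e) = 0)
     \<longleftrightarrow> (\<forall>e\<in>interior_edges K. g e = 0)"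
proof (intro iffI ballI allI impI)
  fix e assume var: "\<forall>\<alpha>. vanishes_on_boundary K 1 \<alpha> \<longrightarrow> (\<Sum>e\<in>cells K 1. \<alpha> e * g e) = 0"
    and e: "e \<in> interior_edges K"
  have "vanishes_on_boundary K 1 (indicator {e})"
    using e unfolding vanishes_on_boundary_def interior_edges_def by (auto simp: indicator_def)
  with var have "(\<Sum>e'\<in>cells K 1. indicator {e} e' * g e') = 0"
    by blast
  then show "g e = 0"
    using e by (simp add: interior_edges_def indicator_def if_distrib[of "\<lambda>x. x * _"]
        finite_cells[OF K] cong: if_cong)
next
  fix \<alpha> assume "\<forall>e\<in>interior_edges K. g e = 0" and "vanishes_on_boundary K 1 \<alpha>"
  then show "(\<Sum>e\<in>cells K 1. \<alpha> e * g e) = 0"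
    by (intro sum.neutral) (auto simp: vanishes_on_boundary_def interior_edges_def)
qed

theorem theorem5p1:
  fixes K :: mesh and J :: dual_form and A :: primal_form
  assumes "spacetime_mesh K"
  shows "(stationary_action K J A \<longleftrightarrow>
            (\<forall>e\<in>interior_edges K. dual_ext_d K 2 (hodge2 K (ext_d K 1 A)) (Star e) = J (Star e))) \<and>
         (stationary_action K J A \<longrightarrow>
            (\<forall>F G. F = ext_d K 1 A \<longrightarrow> G = hodge2 K F \<longrightarrow>
               (\<forall>\<sigma>\<in>cells K 3. ext_d K 2 F \<sigma> = 0) \<and>
               (\<forall>e\<in>interior_edges K. dual_ext_d K 2 G (Star e) = J (Star e))))"
proof -
  let ?EL = "\<forall>e\<in>interior_edges K. dual_ext_d K 2 (hodge2 K (ext_d K 1 A)) (Star e) = J (Star e)"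
  have "stationary_action K J A \<longleftrightarrow> (\<forall>\<alpha>. vanishes_on_boundary K 1 \<alpha> \<longrightarrow> (\<Sum>e\<in>cells K 1.
      \<alpha> e * (J (Star e) - dual_ext_d K 2 (hodge2 K (ext_d K 1 A)) (Star e))) = 0)"
    unfolding stationary_action_def
  proof (intro all_cong1 imp_cong[OF refl])
    fix \<alpha>
    show "((\<lambda>\<epsilon>. action K J (\<lambda>e. A e + \<epsilon> * \<alpha> e)) has_real_derivative 0) (at 0)
      \<longleftrightarrow> (\<Sum>e\<in>cells K 1.
        \<alpha> e * (J (Star e) - dual_ext_d K 2 (hodge2 K (ext_d K 1 A)) (Star e))) = 0"
      using action_derivative[OF assms, of J A \<alpha>] by (auto dest: DERIV_unique)
  qed
  then have "stationary_action K J A \<longleftrightarrow> ?EL"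
    unfolding fundamental_lemma[OF assms] by auto
  moreover have "ext_d K 2 (ext_d K 1 A) \<sigma> = 0" if "\<sigma> \<in> cells K 3" for \<sigma>
    using ext_d_ext_d[OF assms, of \<sigma> 1] that by (simp add: numeral_2_eq_2 numeral_3_eq_3)
  ultimately show ?thesis
    by blast
qed

end
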